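(* Let $\mathcal{H}$ be a Hilbert space, let $\mathcal{D}(Q)\subseteq\mathbb{C}$ be a domain, and let $Q:\mathcal{D}(Q)\to\mathcal{L}(\mathcal{H})$ be an operator-valued function holomorphic on $\mathcal{D}(Q)$. Let $l\in\mathbb{N}$ and let $\alpha\in\mathcal{D}(Q)$ be a zero of $Q(z)$ of order at least $l$ (hence $\alpha$ is not a singularity of $Q$). Let $\boldsymbol{\varphi}(z)$ be an $\mathcal{H}$-valued function, holomorphic at $\alpha$, satisfying $\boldsymbol{\varphi}(\alpha)\neq 0$. Then $\boldsymbol{\varphi}(z)$ is a root function of $Q(z)$ at $\alpha$ of order at least $l$ if and only if it can be written in the form $$\boldsymbol{\varphi}(z)=\sum_{s=0}^{l-1}\frac{1}{s!}(z-\alpha)^{s}\boldsymbol{\varphi}^{(s)}(\alpha)+(z-\alpha)^{l-1}O(z-\alpha),$$ where the derivatives $Q^{(j)}(z)$, $\boldsymbol{\varphi}^{(j)}(z)$, $j=0,1,\dots,l-1$, satisfy the conditions $$\sum_{p=0}^{j}\frac{1}{p!\,(j-p)!}\,Q^{(p)}(\alpha)\,\boldsymbol{\varphi}^{(j-p)}(\alpha)=0,\qquad j=0,\dots,l-1.$$ Here $O(z-\alpha)$ denotes an $\mathcal{H}$-valued function such that, for some $M>0$, $\|O(z-\alpha)\|\le M|z-\alpha|$ as $z\to\alpha$.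
   Context: $\mathbb{N}$ denotes the set of positive integers. $\mathcal{L}(\mathcal{H})$ is the Banach space of bounded linear operators on the Hilbert space $\mathcal{H}$. The domain $\mathcal{D}(Q)$ of $Q$ coincides with its domain of holomorphy. Root function: an $\mathcal{H}$-valued function $\boldsymbol{\varphi}(z)$ is called a root function of $Q(z)$ of order at least $m$ ($m\in\mathbb{N}$) at the critical point (or zero) $\alpha\in\mathbb{C}$ if (a) $\boldsymbol{\varphi}(\alpha)\neq 0$, and (b) $(Q(z)\boldsymbol{\varphi}(z))^{(i)}\to 0$ as $z\to\alpha$ for every integer $0\le i\le m-1$, where $(\cdot)^{(i)}$ denotes the $i$-th derivative with respect to $z$. If $m$ is the maximal number for which (b) holds, $\boldsymbol{\varphi}(z)$ is a root function of exact order $m$ at $\alpha$. The vector $\boldsymbol{\varphi}(\alpha)$ is then called an eigenvector corresponding to the eigenvalue $\alpha$. Order of a zero: a root function $\boldsymbol{\varphi}(z)$ whose order is maximal among all root functions at $\alpha$ with the same eigenvector $\boldsymbol{\varphi}(\alpha)$ is called a canonical root function associated with $\boldsymbol{\varphi}(\alpha)$. The order of the zero at $\alpha$ is the maximal order among all canonical root functions at $\alpha$. Thus "$\alpha$ is a zero of $Q$ of order at least $l$" means that there exists a root function of $Q$ at $\alpha$ of order at least $l$. *)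

theory Defs
  imports "HOL-Analysis.Analysis"
begin

section \<open>Complex Hilbert spaces\<close>

class complex_vector = real_vector +
  fixes scaleC :: "complex \<Rightarrow> 'a \<Rightarrow> 'a"  (infixr \<open>*\<^sub>C\<close> 75)
  assumes scaleC_add_right: "c *\<^sub>C (x + y) = c *\<^sub>C x + c *\<^sub>C y"
    and scaleC_add_left: "(c + d) *\<^sub>C x = c *\<^sub>C x + d *\<^sub>C x"
    and scaleC_scaleC: "c *\<^sub>C d *\<^sub>C x = (c * d) *\<^sub>C x"
    and scaleC_of_real: "complex_of_real r *\<^sub>C x = r *\<^sub>R x"

class complex_normed_vector = complex_vector + real_normed_vector +
  assumes norm_scaleC: "norm (c *\<^sub>C x) = cmod c * norm x"

text \<open>The inner product is linear in the first argument. Positive definiteness is contained in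
  \<open>cinner_self\<close>, because the norm of the type is positive definite.\<close>

class complex_inner = complex_normed_vector +
  fixes cinner :: "'a \<Rightarrow> 'a \<Rightarrow> complex"
  assumes cinner_commute: "cinner x y = cnj (cinner y x)"
    and cinner_add_left: "cinner (x + y) z = cinner x z + cinner y z"
    and cinner_scaleC_left: "cinner (c *\<^sub>C x) y = c * cinner x y"
    and cinner_self: "cinner x x = complex_of_real ((norm x)\<^sup>2)"

class complex_hilbert_space = complex_inner + complete_space

instantiation complex :: complex_hilbert_space
begin

definition scaleC_complex :: "complex \<Rightarrow> complex \<Rightarrow> complex"
  where "scaleC_complex c x = c * x"

definition cinner_complex :: "complex \<Rightarrow> complex \<Rightarrow> complex"
  where "cinner_complex x y = x * cnj y"

instance
  by standard
    (simp_all add: scaleC_complex_def cinner_complex_def algebra_simps scaleR_conv_of_real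
      norm_mult complex_norm_square del: of_real_power)

end

section \<open>Bounded operators\<close>

text \<open>The library type of bounded linear maps consists of the real linear ones. With pointwise
  scalar multiplication it is a complex normed space.\<close>

lemma bounded_linear_scaleC: "bounded_linear (\<lambda>x :: 'a :: complex_normed_vector. c *\<^sub>C x)"
proof (rule bounded_linear_intro)
  show "c *\<^sub>C (r *\<^sub>R x) = r *\<^sub>R (c *\<^sub>C x)" for r and x :: 'a
    by (simp add: scaleC_of_real [symmetric] scaleC_scaleC mult.commute)
  show "norm (c *\<^sub>C x) \<le> norm x * cmod c" for x :: 'a
    by (simp add: norm_scaleC mult.commute)
qed (rule scaleC_add_right)

instantiation blinfun :: (real_normed_vector, complex_normed_vector) complex_normed_vector
begin

lift_definition scaleC_blinfun :: "complex \<Rightarrow> 'a \<Rightarrow>\<^sub>L 'b \<Rightarrow> 'a \<Rightarrow>\<^sub>L 'b" is "\<lambda>c f x. c *\<^sub>C f x"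
  by (rule bounded_linear_compose [OF bounded_linear_scaleC])

instance
proof
  fix c d :: complex and r :: real and f g :: "'a \<Rightarrow>\<^sub>L 'b"
  show "c *\<^sub>C (f + g) = c *\<^sub>C f + c *\<^sub>C g"
    by transfer (simp add: scaleC_add_right)
  show "(c + d) *\<^sub>C f = c *\<^sub>C f + d *\<^sub>C f"
    by transfer (simp add: scaleC_add_left)
  show "c *\<^sub>C d *\<^sub>C f = (c * d) *\<^sub>C f"
    by transfer (simp add: scaleC_scaleC)
  show "complex_of_real r *\<^sub>C f = r *\<^sub>R f"
    by transfer (simp add: scaleC_of_real)
  have le: "norm (b *\<^sub>C h) \<le> cmod b * norm h" for b and h :: "'a \<Rightarrow>\<^sub>L 'b"
  proof (rule norm_blinfun_bound)
    show "norm (blinfun_apply (b *\<^sub>C h) x) \<le> cmod b * norm h * norm x" for x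
      by (simp add: scaleC_blinfun.rep_eq norm_scaleC mult.assoc mult_left_mono norm_blinfun)
  qed simp
  show "norm (c *\<^sub>C f) = cmod c * norm f"
  proof (cases "c = 0")
    case True
    then show ?thesis
      using le [of 0 f] by simp
  next
    case False
    have "inverse c *\<^sub>C c *\<^sub>C f = f"
      using False scaleC_of_real [of 1 "blinfun_apply f x" for x]
      by (auto intro!: blinfun_eqI simp: scaleC_blinfun.rep_eq scaleC_scaleC)
    then have "norm f \<le> inverse (cmod c) * norm (c *\<^sub>C f)"
      using le [of "inverse c" "c *\<^sub>C f"] by (simp add: norm_inverse)
    then have "cmod c * norm f \<le> norm (c *\<^sub>C f)"
      using False by (simp add: field_simps)
    with le [of c f] show ?thesis
      by simp
  qed
qed

end

text \<open>This is \<open>\<L>(\<H>)\<close>: a closed complex subspace of the ambient type, carrying the operator norm,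
  so that limits and derivatives of functions with values in it may be taken in that type.\<close>

definition clinear_operators :: "('a :: complex_normed_vector \<Rightarrow>\<^sub>L 'a) set"
  where "clinear_operators =
    {A. \<forall>c x. blinfun_apply A (c *\<^sub>C x) = c *\<^sub>C blinfun_apply A x}"

section \<open>Vector-valued holomorphic functions\<close>

definition has_cderivative ::
    "(complex \<Rightarrow> 'a :: complex_normed_vector) \<Rightarrow> 'a \<Rightarrow> complex filter \<Rightarrow> bool"
    (infix \<open>has'_cderivative\<close> 50)
  where "(f has_cderivative D) F \<longleftrightarrow> (f has_derivative (\<lambda>h. h *\<^sub>C D)) F"

lemma has_cderivative_complex_iff:
  fixes f :: "complex \<Rightarrow> complex"
  shows "(f has_cderivative D) F \<longleftrightarrow> (f has_field_derivative D) F"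
  by (simp add: has_cderivative_def has_field_derivative_def scaleC_complex_def mult_commute_abs)

definition cdifferentiable ::
    "(complex \<Rightarrow> 'a :: complex_normed_vector) \<Rightarrow> complex filter \<Rightarrow> bool"
    (infix \<open>cdifferentiable\<close> 50)
  where "f cdifferentiable F \<longleftrightarrow> (\<exists>D. (f has_cderivative D) F)"

definition cderiv :: "(complex \<Rightarrow> 'a :: complex_normed_vector) \<Rightarrow> complex \<Rightarrow> 'a"
  where "cderiv f z = (SOME D. (f has_cderivative D) (at z))"

definition cholomorphic_on ::
    "(complex \<Rightarrow> 'a :: complex_normed_vector) \<Rightarrow> complex set \<Rightarrow> bool"
    (infixl \<open>cholomorphic'_on\<close> 50)
  where "f cholomorphic_on S \<longleftrightarrow> (\<forall>z\<in>S. f cdifferentiable (at z within S))"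

definition cholomorphic_at ::
    "(complex \<Rightarrow> 'a :: complex_normed_vector) \<Rightarrow> complex \<Rightarrow> bool"
    (infixl \<open>cholomorphic'_at\<close> 50)
  where "f cholomorphic_at z \<longleftrightarrow> (\<exists>e>0. f cholomorphic_on ball z e)"

section \<open>Root functions and zeros\<close>

text \<open>Since \<^const>\<open>cderiv\<close> is total, the existence near \<open>\<alpha>\<close> of the derivatives up to order
  \<open>m - 1\<close>, implicit in speaking of their limits, is required explicitly. Neither holomorphy nor
  continuity of \<open>\<phi>\<close> is part of the notion.\<close>

definition root_function_of_order_at_least ::
    "(complex \<Rightarrow> 'a :: complex_normed_vector \<Rightarrow>\<^sub>L 'a) \<Rightarrow> complex \<Rightarrow> nat \<Rightarrow> (complex \<Rightarrow> 'a) \<Rightarrow> bool"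
  where "root_function_of_order_at_least Q \<alpha> m \<phi> \<longleftrightarrow>
    \<phi> \<alpha> \<noteq> 0 \<and>
    (let f = (\<lambda>z. blinfun_apply (Q z) (\<phi> z)) in
      (\<forall>i. i + 1 < m \<longrightarrow> (\<forall>\<^sub>F z in at \<alpha>. (cderiv ^^ i) f cdifferentiable (at z))) \<and>
      (\<forall>i<m. ((cderiv ^^ i) f \<longlongrightarrow> 0) (at \<alpha>)))"

definition zero_of_order_at_least ::
    "(complex \<Rightarrow> 'a :: complex_normed_vector \<Rightarrow>\<^sub>L 'a) \<Rightarrow> complex \<Rightarrow> nat \<Rightarrow> bool"
  where "zero_of_order_at_least Q \<alpha> m \<longleftrightarrow>
    (\<exists>\<psi>. root_function_of_order_at_least Q \<alpha> m \<psi>)"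

end

theory Submission
  imports Defs "HOL-Complex_Analysis.Cauchy_Integral_Formula"
begin

text \<open>
  Put \<open>f z = Q z (\<phi> z)\<close>. The Leibniz rule gives
  \<open>f\<^sup>(\<^sup>j\<^sup>) \<alpha> = j! G\<^sub>j\<close>, where \<open>G\<^sub>j\<close> is the sum of
  \<open>1 / (p! (j - p)!) Q\<^sup>(\<^sup>p\<^sup>) \<alpha> (\<phi>\<^sup>(\<^sup>j\<^sup>-\<^sup>p\<^sup>) \<alpha>)\<close> over \<open>p \<le> j\<close>
  (\<open>higher_cderiv_blinfun_apply\<close>). The derivatives of \<open>f\<close> are continuous, so
  \<open>f\<^sup>(\<^sup>j\<^sup>) z \<longlongrightarrow> 0\<close> as \<open>z \<longlongrightarrow> \<alpha>\<close> says exactly that \<open>G\<^sub>j = 0\<close>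
  (\<open>root_function_of_order_at_least_iff\<close>). The expansion of \<open>\<phi>\<close> with its remainder is Taylor's
  formula, true of every holomorphic \<open>\<phi>\<close> (\<open>cholomorphic_Taylor_bound\<close>).

  What has to be built is the calculus of holomorphic functions with values in \<open>\<H>\<close> and in
  \<open>\<L>(\<H>)\<close>, above all that a complex derivative is again complex differentiable
  (\<open>cderiv_cdifferentiable\<close>). It is reduced to scalar functions by a norming family of
  functionals: \<open>v \<mapsto> \<langle>v, y\<rangle>\<close> on \<open>\<H>\<close> and \<open>A \<mapsto> \<langle>A x, y\<rangle>\<close> on \<open>\<L>(\<H>)\<close>, with
  \<open>x\<close> and \<open>y\<close> in the unit ball. For each such \<open>\<mu>\<close> and each vector-valued
  holomorphic \<open>g\<close> the scalar function \<open>\<mu> \<circ> g\<close> is holomorphic, and Cauchy's estimates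
  for it involve only a bound of \<open>\<parallel>g\<parallel>\<close>, hence are uniform
  in \<open>\<mu>\<close>. Because the family determines the norm, uniform scalar estimates are norm estimates,
  and completeness then turns the Cauchy property of difference quotients into a limit.
\<close>

section \<open>Complex scaling and the inner product\<close>

lemma scaleC_one [simp]: "1 *\<^sub>C x = x"
  using scaleC_of_real [of 1 x] by simp

lemma bounded_bilinear_scaleC:
  "bounded_bilinear ((*\<^sub>C) :: complex \<Rightarrow> 'a :: complex_normed_vector \<Rightarrow> 'a)"
proof
  show "(r *\<^sub>R c) *\<^sub>C x = r *\<^sub>R c *\<^sub>C x" for r c and x :: 'a
    by (simp add: scaleC_of_real [symmetric] scaleC_scaleC) (simp only: scaleC_complex_def)
  show "c *\<^sub>C r *\<^sub>R x = r *\<^sub>R c *\<^sub>C x" for r c and x :: 'a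
    by (simp add: scaleC_of_real [symmetric] scaleC_scaleC mult.commute)
  show "\<exists>K. \<forall>c. \<forall>x :: 'a. norm (c *\<^sub>C x) \<le> norm c * norm x * K"
    by (rule exI [of _ 1]) (simp add: norm_scaleC)
qed (rule scaleC_add_left scaleC_add_right)+

interpretation scaleC: bounded_bilinear
  "(*\<^sub>C) :: complex \<Rightarrow> 'a :: complex_normed_vector \<Rightarrow> 'a"
  by (rule bounded_bilinear_scaleC)

lemma scaleC_eq_0_iff: "c *\<^sub>C x = 0 \<longleftrightarrow> c = 0 \<or> x = 0"
  for x :: "'a :: complex_normed_vector"
  by (metis mult_eq_0_iff norm_eq_zero norm_scaleC)

lemma cinner_zero_right [simp]: "cinner x 0 = 0"
proof -
  have "cinner (0 + 0) x = cinner 0 x + cinner 0 x"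
    by (rule cinner_add_left)
  then show ?thesis
    using cinner_commute [of x 0] by simp
qed

lemma cinner_diff_left: "cinner (x - y) z = cinner x z - cinner y z"
  using cinner_add_left [of "x - y" y z] by simp

lemma cinner_scaleC_right: "cinner x (c *\<^sub>C y) = cnj c * cinner x y"
  by (metis cinner_commute cinner_scaleC_left complex_cnj_mult)

lemma cinner_diff_right: "cinner x (y - z) = cinner x y - cinner x z"
  by (metis cinner_commute cinner_diff_left complex_cnj_diff)

text \<open>The usual argument: the squared norm of \<open>\<parallel>y\<parallel>\<^sup>2 x - \<langle>x, y\<rangle> y\<close>, which is
  \<open>\<parallel>y\<parallel>\<^sup>2\<close> times the component of \<open>x\<close> orthogonal to \<open>y\<close>, is nonnegative.\<close>

lemma Cauchy_Schwarz_cinner: "cmod (cinner x y) \<le> norm x * norm y"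
proof (cases "y = 0")
  case False
  define c where "c = cinner x y"
  define N where "N = complex_of_real ((norm y)\<^sup>2)"
  define v where "v = N *\<^sub>C x - c *\<^sub>C y"
  have yx: "cinner y x = cnj c"
    unfolding c_def by (rule cinner_commute)
  have "complex_of_real ((norm v)\<^sup>2) = cinner v v"
    by (simp only: cinner_self)
  also have "\<dots> = N * (N * complex_of_real ((norm x)\<^sup>2) - c * cnj c)"
  proof -
    have "cnj N = N" "cinner y y = N"
      unfolding N_def cinner_self by (rule complex_cnj_complex_of_real refl)+
    then show ?thesis
      by (simp add: v_def cinner_diff_left cinner_diff_right cinner_scaleC_left
          cinner_scaleC_right cinner_self [of x] yx c_def [symmetric] algebra_simps
          del: of_real_power)
  qed
  also have "\<dots> = complex_of_real ((norm y)\<^sup>2 * ((norm y)\<^sup>2 * (norm x)\<^sup>2 - (cmod c)\<^sup>2))"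
    by (simp add: N_def complex_norm_square del: of_real_power)
  finally have "(norm v)\<^sup>2 = (norm y)\<^sup>2 * ((norm y)\<^sup>2 * (norm x)\<^sup>2 - (cmod c)\<^sup>2)"
    using of_real_eq_iff by blast
  then have "0 \<le> (norm y)\<^sup>2 * ((norm y)\<^sup>2 * (norm x)\<^sup>2 - (cmod c)\<^sup>2)"
    by (metis zero_le_power2)
  with False have "(cmod c)\<^sup>2 \<le> (norm x * norm y)\<^sup>2"
    by (simp add: zero_le_mult_iff power_mult_distrib mult.commute)
  then show ?thesis
    unfolding c_def by (rule power2_le_imp_le) simp
qed simp

text \<open>This makes the operator space complete through the library instance for \<open>blinfun\<close>.\<close>

subclass (in complex_hilbert_space) banach ..

section \<open>Norming families of functionals\<close>

text \<open>Such a family supplies what the Hahn--Banach theorem would give in an arbitrary Banach space.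
  Since \<open>K\<close> may be negative, the second clause makes \<open>\<Lambda>\<close> nonempty.\<close>

definition norming_functionals :: "('a :: complex_normed_vector \<Rightarrow> complex) set \<Rightarrow> bool"
  where "norming_functionals \<Lambda> \<longleftrightarrow>
    (\<forall>\<mu>\<in>\<Lambda>. bounded_linear \<mu> \<and> (\<forall>c x. \<mu> (c *\<^sub>C x) = c * \<mu> x) \<and> (\<forall>x. cmod (\<mu> x) \<le> norm x)) \<and>
    (\<forall>x K. (\<forall>\<mu>\<in>\<Lambda>. cmod (\<mu> x) \<le> K) \<longrightarrow> norm x \<le> K)"

lemma norming_functionalsD:
  assumes "norming_functionals \<Lambda>" "\<mu> \<in> \<Lambda>"
  shows "bounded_linear \<mu>" "\<mu> (c *\<^sub>C x) = c * \<mu> x" "cmod (\<mu> x) \<le> norm x"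
  using assms unfolding norming_functionals_def by blast+

lemma norming_functionals_norm_le:
  assumes "norming_functionals \<Lambda>" "\<And>\<mu>. \<mu> \<in> \<Lambda> \<Longrightarrow> cmod (\<mu> x) \<le> K"
  shows "norm x \<le> K"
  using assms unfolding norming_functionals_def by blast

lemma bounded_linear_cinner_left: "bounded_linear (\<lambda>x. cinner x y)"
  by (rule bounded_linear_intro [of _ "norm y"])
    (simp_all add: cinner_add_left Cauchy_Schwarz_cinner cinner_scaleC_left
      flip: scaleC_of_real add: scaleC_complex_def)

text \<open>Test against the normalised vector \<open>y = x / \<parallel>x\<parallel>\<close>, for which the inner product is
  \<open>\<parallel>x\<parallel>\<close>.\<close>

lemma norm_le_if_cinner_le:
  fixes x :: "'a :: complex_inner"
  assumes "\<And>y :: 'a. norm y \<le> 1 \<Longrightarrow> cmod (cinner x y) \<le> K"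
  shows "norm x \<le> K"
proof (cases "x = 0")
  case True
  then show ?thesis
    using assms [of 0] by simp
next
  case False
  let ?y = "complex_of_real (1 / norm x) *\<^sub>C x"
  have "norm x = cmod (cinner x ?y)"
    using False
    by (simp add: cinner_scaleC_right cinner_self norm_mult norm_divide power2_eq_square)
  also have "\<dots> \<le> K"
    using False by (intro assms) (simp add: norm_scaleC norm_divide)
  finally show ?thesis .
qed

lemma norming_functionals_cinner:
  "norming_functionals ((\<lambda>y x. cinner x y) ` cball (0 :: 'a :: complex_inner) 1)"
proof -
  have "cmod (cinner x y) \<le> norm x" if "norm y \<le> 1" for x y :: 'a
    using Cauchy_Schwarz_cinner [of x y] mult_left_mono [OF that, of "norm x"] by simp
  then show ?thesis
    unfolding norming_functionals_def
    by (auto simp: bounded_linear_cinner_left cinner_scaleC_left intro: norm_le_if_cinner_le)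
qed

text \<open>The operator norm is the supremum of \<open>\<parallel>A x\<parallel>\<close> over the unit ball, and each
  \<open>\<parallel>A x\<parallel>\<close> is in turn the supremum of \<open>\<bar>\<langle>A x, y\<rangle>\<bar>\<close> over the unit ball.\<close>

lemma norming_functionals_blinfun:
  "norming_functionals
    ((\<lambda>(x, y) A. cinner (blinfun_apply A x) y) `
      (cball (0 :: 'a :: complex_inner) 1 \<times> cball (0 :: 'b :: complex_inner) 1))"
proof -
  have bl: "bounded_linear (\<lambda>A. cinner (blinfun_apply A x) y)" for x :: 'a and y :: 'b
    by (rule bounded_linear_compose [OF bounded_linear_cinner_left])
      (rule blinfun.bounded_linear_left)
  have le: "cmod (cinner (blinfun_apply A x) y) \<le> norm A"
    if "norm x \<le> 1" "norm y \<le> 1" for A :: "'a \<Rightarrow>\<^sub>L 'b" and x y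
  proof -
    have "norm A * norm x * norm y \<le> norm A"
      using that by (metis mult_left_le mult_mono' norm_ge_zero order_refl order_trans mult.assoc
          mult_le_one)
    moreover have "norm (blinfun_apply A x) * norm y \<le> norm A * norm x * norm y"
      by (intro mult_right_mono norm_blinfun) simp
    ultimately show ?thesis
      using Cauchy_Schwarz_cinner [of "blinfun_apply A x" y] by linarith
  qed
  have norming: "norm A \<le> K"
    if K: "\<And>x y. norm x \<le> 1 \<Longrightarrow> norm y \<le> 1 \<Longrightarrow> cmod (cinner (blinfun_apply A x) y) \<le> K"
    for A :: "'a \<Rightarrow>\<^sub>L 'b" and K
  proof (rule norm_blinfun_bound)
    show "0 \<le> K"
      using K [of 0 0] by simp
    have unit: "norm (blinfun_apply A x) \<le> K" if "norm x \<le> 1" for x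
      by (rule norm_le_if_cinner_le) (rule K [OF that])
    show "norm (blinfun_apply A x) \<le> K * norm x" for x
    proof (cases "x = 0")
      case False
      then have "norm (blinfun_apply A ((1 / norm x) *\<^sub>R x)) \<le> K"
        by (intro unit) simp
      with False show ?thesis
        by (simp add: blinfun.scaleR_right field_simps)
    qed simp
  qed
  show ?thesis
    unfolding norming_functionals_def
    by (auto simp: bl le scaleC_blinfun.rep_eq cinner_scaleC_left intro!: norming)
qed

section \<open>Derivatives of vector-valued holomorphic functions\<close>

lemma has_cderivative_cderiv:
  assumes "f cdifferentiable (at z)"
  shows "(f has_cderivative cderiv f z) (at z)"
  using assms unfolding cdifferentiable_def cderiv_def by (rule someI_ex)

lemma has_cderivative_imp_cdifferentiable:
  "(f has_cderivative D) F \<Longrightarrow> f cdifferentiable F"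
  unfolding cdifferentiable_def by blast

lemma cderiv_eqI:
  assumes "(f has_cderivative D) (at z)"
  shows "cderiv f z = D"
proof -
  have "(f has_cderivative cderiv f z) (at z)"
    using assms has_cderivative_cderiv has_cderivative_imp_cdifferentiable by blast
  with assms have "(\<lambda>h. h *\<^sub>C cderiv f z) = (\<lambda>h. h *\<^sub>C D)"
    unfolding has_cderivative_def by (blast intro: has_derivative_unique)
  from fun_cong [OF this, of 1] show ?thesis
    by simp
qed

lemma has_cderivative_transform_open:
  assumes "(f has_cderivative D) (at z)" "open S" "z \<in> S" "\<And>w. w \<in> S \<Longrightarrow> f w = g w"
  shows "(g has_cderivative D) (at z)"
  using assms unfolding has_cderivative_def by (blast intro: has_derivative_transform_within_open)

lemma cholomorphic_on_open:
  assumes "open S"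
  shows "f cholomorphic_on S \<longleftrightarrow> (\<forall>z\<in>S. f cdifferentiable (at z))"
  using assms unfolding cholomorphic_on_def by (metis at_within_open)

lemma cholomorphic_on_subset:
  "f cholomorphic_on S \<Longrightarrow> T \<subseteq> S \<Longrightarrow> f cholomorphic_on T"
  unfolding cholomorphic_on_def cdifferentiable_def has_cderivative_def
  by (meson has_derivative_subset subset_iff)

lemma cdifferentiable_imp_continuous:
  "f cdifferentiable (at z within S) \<Longrightarrow> continuous (at z within S) f"
  unfolding cdifferentiable_def has_cderivative_def
  by (blast intro: has_derivative_continuous)

lemma cholomorphic_on_imp_continuous_on: "f cholomorphic_on S \<Longrightarrow> continuous_on S f"
  unfolding cholomorphic_on_def continuous_on_eq_continuous_within
  by (blast intro: cdifferentiable_imp_continuous)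

lemma norming_functional_has_field_derivative:
  assumes "norming_functionals \<Lambda>" "\<mu> \<in> \<Lambda>" "(f has_cderivative D) (at z)"
  shows "((\<lambda>w. \<mu> (f w)) has_field_derivative \<mu> D) (at z)"
proof -
  have "((\<lambda>w. \<mu> (f w)) has_derivative (\<lambda>h. \<mu> (h *\<^sub>C D))) (at z)"
    using assms(3) unfolding has_cderivative_def
    by (rule bounded_linear.has_derivative [OF norming_functionalsD(1) [OF assms(1,2)]])
  then show ?thesis
    by (simp add: norming_functionalsD(2) [OF assms(1,2)] has_field_derivative_def
        mult_commute_abs)
qed

text \<open>A bound for the error in differentiating \<open>g'\<close> that depends on \<open>g\<close> only through its
  size. It is Taylor's formula of degree one for \<open>g'\<close>; the third derivative of \<open>g\<close> in the
  remainder is at most \<open>3! M / r\<^sup>3\<close> on the ball of radius \<open>r\<close>, by Cauchy's inequality on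
  circles of radius \<open>r\<close>, which stay in the ball of radius \<open>2 r\<close>.\<close>

lemma deriv_difference_bound:
  assumes holo: "g holomorphic_on S" and "open S" and "cball z (2 * r) \<subseteq> S" and "0 < r"
    and bound: "\<And>w. w \<in> cball z (2 * r) \<Longrightarrow> cmod (g w) \<le> M"
    and "cmod h \<le> r"
  shows "cmod (deriv g (z + h) - deriv g z - h * deriv (deriv g) z) \<le> 6 * M / r ^ 3 * (cmod h)\<^sup>2"
proof -
  let ?f = "\<lambda>i. (deriv ^^ Suc i) g"
  have sub: "cball w r \<subseteq> cball z (2 * r)" if "w \<in> cball z r" for w
    using that by (simp add: cball_subset_cball_iff dist_commute)
  have "cmod (?f 0 (z + h) - (\<Sum>i\<le>1. ?f i z * ((z + h) - z) ^ i / fact i))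
    \<le> 6 * M / r ^ 3 * cmod ((z + h) - z) ^ Suc 1 / fact 1"
  proof (rule complex_Taylor [where S = "cball z r"])
    fix i :: nat and w
    assume "w \<in> cball z r"
    moreover from this have "w \<in> S"
      using sub assms(3,4) by fastforce
    ultimately show "(?f i has_field_derivative ?f (Suc i) w) (at w within cball z r)"
      using holomorphic_derivI [OF holomorphic_higher_deriv [OF holo \<open>open S\<close>, of "Suc i"]
          \<open>open S\<close>] by simp
  next
    fix w
    assume w: "w \<in> cball z r"
    have "cball w r \<subseteq> S"
      using sub [OF w] assms(3) by blast
    then have "g holomorphic_on cball w r"
      using holo holomorphic_on_subset by blast
    then have "cmod ((deriv ^^ 3) g w) \<le> fact 3 * M / r ^ 3"
      using sub [OF w] \<open>0 < r\<close>
      by (intro Cauchy_inequality bound)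
        (auto intro: holomorphic_on_subset holomorphic_on_imp_continuous_on
          simp: subset_iff dist_norm)
    then show "cmod (?f (Suc 1) w) \<le> 6 * M / r ^ 3"
      by (simp add: eval_nat_numeral)
  qed (use assms in \<open>auto simp: dist_norm\<close>)
  then show ?thesis
    by (simp add: algebra_simps power2_eq_square)
qed

text \<open>Applied to \<open>\<mu> \<circ> f\<close> the preceding bound has a constant \<open>K\<close> independent of
  \<open>\<mu>\<close>. The scalar second derivatives cannot yet be put together to a vector, but they drop out
  when two difference quotients of \<open>cderiv f\<close> are compared; so the quotients \<open>q h\<close> are Cauchy in
  norm as \<open>h \<longlongrightarrow> 0\<close>, and their limit is the derivative.\<close>

lemma cderiv_cdifferentiable:
  fixes f :: "complex \<Rightarrow> 'a :: {complex_normed_vector, banach}"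
  assumes norming: "norming_functionals (\<Lambda> :: ('a \<Rightarrow> complex) set)"
    and holo: "f cholomorphic_on S" and "open S" and "z \<in> S"
  shows "cderiv f cdifferentiable (at z)"
proof -
  obtain e where "0 < e" and e: "cball z e \<subseteq> S"
    using assms(3,4) open_contains_cball by blast
  define r where "r = e / 2"
  have "0 < r" and r: "cball z (2 * r) \<subseteq> S"
    using \<open>0 < e\<close> e by (simp_all add: r_def)
  have "compact (f ` cball z (2 * r))"
    using cholomorphic_on_imp_continuous_on [OF cholomorphic_on_subset [OF holo r]]
    by (intro compact_continuous_image) simp_all
  then obtain M where M: "\<And>w. w \<in> cball z (2 * r) \<Longrightarrow> norm (f w) \<le> M"
    by (metis bounded_iff compact_imp_bounded imageI)
  define K where "K = 6 * M / r ^ 3"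
  define q where "q h = inverse h *\<^sub>C (cderiv f (z + h) - cderiv f z)" for h
  have "0 \<le> K"
    using order_trans [OF norm_ge_zero M [of z]] \<open>0 < r\<close> by (simp add: K_def)
  have q_functional: "cmod (\<mu> (q h) - deriv (deriv (\<lambda>w. \<mu> (f w))) z) \<le> K * cmod h"
    if \<mu>: "\<mu> \<in> \<Lambda>" and h: "h \<noteq> 0" "cmod h \<le> r" for \<mu> h
  proof -
    let ?g = "\<lambda>w. \<mu> (f w)"
    have D: "(?g has_field_derivative \<mu> (cderiv f w)) (at w)" if "w \<in> S" for w
      using holo that \<open>open S\<close>
      by (intro norming_functional_has_field_derivative [OF norming \<mu>] has_cderivative_cderiv)
        (simp add: cholomorphic_on_open)
    then have "?g holomorphic_on S"
      using \<open>open S\<close> by (auto simp: holomorphic_on_open)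
    moreover have "cmod (?g w) \<le> M" if "w \<in> cball z (2 * r)" for w
      using norming_functionalsD(3) [OF norming \<mu>] M [OF that] by (rule order_trans)
    ultimately have
      "cmod (deriv ?g (z + h) - deriv ?g z - h * deriv (deriv ?g) z) \<le> K * (cmod h)\<^sup>2"
      unfolding K_def using deriv_difference_bound \<open>open S\<close> r \<open>0 < r\<close> h(2) by blast
    moreover have "deriv ?g w = \<mu> (cderiv f w)" if "w \<in> S" for w
      by (rule DERIV_imp_deriv) (rule D [OF that])
    moreover have "z + h \<in> S"
      using h \<open>0 < r\<close> r by (auto simp: subset_iff dist_norm)
    ultimately have "cmod (\<mu> (cderiv f (z + h) - cderiv f z) - h * deriv (deriv ?g) z)
      \<le> K * (cmod h)\<^sup>2"
      using \<open>z \<in> S\<close> by (simp add: linear_diff bounded_linear.linear norming_functionalsD(1) [OF norming \<mu>])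
    moreover have "\<mu> (cderiv f (z + h) - cderiv f z) = h * \<mu> (q h)"
      using h by (simp add: q_def norming_functionalsD(2) [OF norming \<mu>])
    ultimately have "cmod h * cmod (\<mu> (q h) - deriv (deriv ?g) z) \<le> cmod h * (K * cmod h)"
      by (simp add: right_diff_distrib [symmetric] norm_mult power2_eq_square mult_ac)
    then show ?thesis
      using h by simp
  qed
  have q_close: "norm (q h - q k) \<le> K * (cmod h + cmod k)"
    if "h \<noteq> 0" "cmod h \<le> r" "k \<noteq> 0" "cmod k \<le> r" for h k
  proof (rule norming_functionals_norm_le [OF norming])
    fix \<mu>
    assume \<mu>: "\<mu> \<in> \<Lambda>"
    let ?d = "deriv (deriv (\<lambda>w. \<mu> (f w))) z"
    have "\<mu> (q h - q k) = (\<mu> (q h) - ?d) - (\<mu> (q k) - ?d)"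
      by (simp add: linear_diff bounded_linear.linear norming_functionalsD(1) [OF norming \<mu>])
    then show "cmod (\<mu> (q h - q k)) \<le> K * (cmod h + cmod k)"
      using norm_triangle_ineq4 [of "\<mu> (q h) - ?d" "\<mu> (q k) - ?d"]
        q_functional [OF \<mu>, of h] q_functional [OF \<mu>, of k] that by (simp add: distrib_left)
  qed
  \<comment> \<open>The limit is taken along one null sequence; \<open>q_close\<close> extends it to all small \<open>h\<close>.\<close>
  define s :: "nat \<Rightarrow> complex" where "s n = complex_of_real (r / (real n + 1))" for n
  have norm_s: "cmod (s n) = r / (real n + 1)" for n
    unfolding s_def norm_of_real using \<open>0 < r\<close> by simp
  have s: "s n \<noteq> 0" "cmod (s n) \<le> r" for n
    using \<open>0 < r\<close> norm_s [of n] by (auto simp: field_simps)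
  have s_lim: "(\<lambda>n. cmod (s n)) \<longlonglongrightarrow> 0"
    unfolding norm_s using LIMSEQ_inverse_real_of_nat [THEN tendsto_mult_left, of r]
    by (simp add: divide_inverse add.commute)
  have "Cauchy (\<lambda>n. q (s n))"
  proof (rule metric_CauchyI)
    fix \<epsilon> :: real
    assume "0 < \<epsilon>"
    have "(\<lambda>n. K * cmod (s n)) \<longlonglongrightarrow> 0"
      using tendsto_mult_left [OF s_lim, of K] by simp
    then have "\<forall>\<^sub>F n in sequentially. K * cmod (s n) < \<epsilon> / 2"
      using \<open>0 < \<epsilon>\<close> by (intro order_tendstoD(2) [where y = 0]) simp_all
    then obtain N where N: "\<And>n. n \<ge> N \<Longrightarrow> K * cmod (s n) < \<epsilon> / 2"
      by (auto simp: eventually_sequentially)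
    show "\<exists>N. \<forall>m\<ge>N. \<forall>n\<ge>N. dist (q (s m)) (q (s n)) < \<epsilon>"
    proof (intro exI [of _ N] allI impI)
      fix m n
      assume "N \<le> m" "N \<le> n"
      then show "dist (q (s m)) (q (s n)) < \<epsilon>"
        using q_close [of "s m" "s n"] s N [of m] N [of n]
        by (simp add: dist_norm distrib_left)
    qed
  qed
  then obtain L where L: "(\<lambda>n. q (s n)) \<longlonglongrightarrow> L"
    using Cauchy_convergent convergent_def by blast
  have q_limit: "norm (q h - L) \<le> K * cmod h" if "h \<noteq> 0" "cmod h \<le> r" for h
  proof (rule tendsto_le)
    show "(\<lambda>n. norm (q h - q (s n))) \<longlonglongrightarrow> norm (q h - L)"
      by (intro tendsto_intros L)
    show "(\<lambda>n. K * (cmod h + cmod (s n))) \<longlonglongrightarrow> K * cmod h"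
      using tendsto_mult_left [OF tendsto_add [OF tendsto_const s_lim], of K "cmod h"] by simp
    show "\<forall>\<^sub>F n in sequentially. norm (q h - q (s n)) \<le> K * (cmod h + cmod (s n))"
      using q_close that s by simp
  qed simp
  have "(cderiv f has_derivative (\<lambda>h. h *\<^sub>C L)) (at z)"
  proof (rule has_derivativeI_sandwich [where H = "\<lambda>w. K * cmod (w - z)"])
    show "bounded_linear (\<lambda>h. h *\<^sub>C L)"
      by (rule scaleC.bounded_linear_left)
    show "((\<lambda>w. K * cmod (w - z)) \<longlongrightarrow> 0) (at z)"
      by (auto intro!: tendsto_eq_intros)
    fix w
    assume "w \<noteq> z" "dist w z < r"
    let ?h = "w - z"
    have "?h \<noteq> 0" "cmod ?h \<le> r"
      using \<open>w \<noteq> z\<close> \<open>dist w z < r\<close> by (simp_all add: dist_norm)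
    moreover have "cderiv f w - cderiv f z - ?h *\<^sub>C L = ?h *\<^sub>C (q ?h - L)"
      using \<open>w \<noteq> z\<close> by (simp add: q_def scaleC.diff_right scaleC_scaleC)
    ultimately show "norm (cderiv f w - cderiv f z - ?h *\<^sub>C L) / norm ?h \<le> K * cmod ?h"
      using q_limit [of ?h] by (simp add: norm_scaleC)
  qed (rule \<open>0 < r\<close>)
  then show ?thesis
    unfolding cdifferentiable_def has_cderivative_def by blast
qed

lemma higher_cderiv_cholomorphic_on:
  fixes f :: "complex \<Rightarrow> 'a :: {complex_normed_vector, banach}"
  assumes "norming_functionals (\<Lambda> :: ('a \<Rightarrow> complex) set)" "f cholomorphic_on S" "open S"
  shows "(cderiv ^^ n) f cholomorphic_on S"
proof (induction n)
  case (Suc n)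
  then show ?case
    using cderiv_cdifferentiable [OF assms(1) Suc \<open>open S\<close>] \<open>open S\<close>
    by (simp add: cholomorphic_on_open)
qed (simp add: assms)

lemma higher_cderiv_has_cderivative:
  fixes f :: "complex \<Rightarrow> 'a :: {complex_normed_vector, banach}"
  assumes "norming_functionals (\<Lambda> :: ('a \<Rightarrow> complex) set)" "f cholomorphic_on S" "open S" "z \<in> S"
  shows "((cderiv ^^ n) f has_cderivative (cderiv ^^ Suc n) f z) (at z)"
  using higher_cderiv_cholomorphic_on [OF assms(1-3), of n] assms(3,4)
  by (simp add: has_cderivative_cderiv cholomorphic_on_open)

section \<open>Taylor's formula\<close>

text \<open>The scalar formula for \<open>\<mu> \<circ> f\<close> has its remainder bounded by the norm of the vector
  derivative of order \<open>n + 1\<close>, uniformly in \<open>\<mu>\<close>.\<close>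

lemma cholomorphic_Taylor_bound:
  fixes f :: "complex \<Rightarrow> 'a :: {complex_normed_vector, banach}"
  assumes norming: "norming_functionals (\<Lambda> :: ('a \<Rightarrow> complex) set)"
    and holo: "f cholomorphic_on S" and "open S" and "a \<in> S"
  shows "\<exists>M>0. \<forall>\<^sub>F z in nhds a.
    norm (f z - (\<Sum>s\<le>n. (1 / fact s) *\<^sub>C (z - a) ^ s *\<^sub>C (cderiv ^^ s) f a))
      \<le> M * cmod (z - a) ^ Suc n"
proof -
  obtain e where "0 < e" and e: "cball a e \<subseteq> S"
    using assms(3,4) open_contains_cball by blast
  have "compact ((cderiv ^^ Suc n) f ` cball a e)"
    using higher_cderiv_cholomorphic_on [OF norming holo \<open>open S\<close>] e
    by (intro compact_continuous_image)
      (blast intro: cholomorphic_on_imp_continuous_on cholomorphic_on_subset compact_cball)+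
  then obtain M where "0 < M" and M: "\<And>w. w \<in> cball a e \<Longrightarrow> norm ((cderiv ^^ Suc n) f w) \<le> M"
    by (metis bounded_pos compact_imp_bounded imageI)
  have "norm (f z - (\<Sum>s\<le>n. (1 / fact s) *\<^sub>C (z - a) ^ s *\<^sub>C (cderiv ^^ s) f a))
      \<le> M / fact n * cmod (z - a) ^ Suc n" if z: "z \<in> cball a e" for z
  proof (rule norming_functionals_norm_le [OF norming])
    fix \<mu>
    assume \<mu>: "\<mu> \<in> \<Lambda>"
    note lin = bounded_linear.linear [OF norming_functionalsD(1) [OF norming \<mu>]]
    let ?g = "\<lambda>i w. \<mu> ((cderiv ^^ i) f w)"
    have "cmod (?g 0 z - (\<Sum>i\<le>n. ?g i a * (z - a) ^ i / fact i))
      \<le> M * cmod (z - a) ^ Suc n / fact n"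
    proof (rule complex_Taylor [where S = "cball a e"])
      fix i w
      assume "w \<in> cball a e"
      then show "(?g i has_field_derivative ?g (Suc i) w) (at w within cball a e)"
        using norming_functional_has_field_derivative [OF norming \<mu>
            higher_cderiv_has_cderivative [OF norming holo \<open>open S\<close>]] e
        by (meson has_field_derivative_at_within subset_iff)
    next
      fix w
      assume "w \<in> cball a e"
      then show "cmod (?g (Suc n) w) \<le> M"
        using norming_functionalsD(3) [OF norming \<mu>] M order_trans by blast
    qed (use z \<open>0 < e\<close> in auto)
    then show "cmod (\<mu> (f z - (\<Sum>s\<le>n. (1 / fact s) *\<^sub>C (z - a) ^ s *\<^sub>C (cderiv ^^ s) f a)))
      \<le> M / fact n * cmod (z - a) ^ Suc n"
      by (simp add: linear_diff [OF lin] linear_sum [OF lin] norming_functionalsD(2) [OF norming \<mu>]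
          mult_ac)
  qed
  moreover have "\<forall>\<^sub>F z in nhds a. z \<in> cball a e"
    unfolding eventually_nhds_metric using \<open>0 < e\<close>
    by (auto simp: dist_commute intro!: exI [of _ e])
  ultimately show ?thesis
    using \<open>0 < M\<close> by (intro exI [of _ "M / fact n"]) (auto elim: eventually_mono)
qed

section \<open>The Leibniz rule for an operator function applied to a vector function\<close>

text \<open>The operators of the ambient type are only real linear. Complex linearity is a closed linear
  condition on the values of \<open>Q\<close> and so passes to the derivative: for fixed \<open>c\<close> and \<open>x\<close>, both
  sides of \<open>Q w (c x) = c (Q w x)\<close> are differentiated with respect to \<open>w\<close>.\<close>

lemma cderiv_clinear_operators:
  fixes Q :: "complex \<Rightarrow> 'a :: complex_normed_vector \<Rightarrow>\<^sub>L 'a"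
  assumes "open S" "z \<in> S" "\<And>w. w \<in> S \<Longrightarrow> Q w \<in> clinear_operators" "Q cholomorphic_on S"
  shows "cderiv Q z \<in> clinear_operators"
proof -
  have D: "(Q has_derivative (\<lambda>h. h *\<^sub>C cderiv Q z)) (at z)"
    using assms has_cderivative_cderiv by (auto simp: cholomorphic_on_open has_cderivative_def)
  have "blinfun_apply (cderiv Q z) (c *\<^sub>C x) = c *\<^sub>C blinfun_apply (cderiv Q z) x" for c x
  proof -
    have 1: "((\<lambda>w. blinfun_apply (Q w) (c *\<^sub>C x)) has_derivative
        (\<lambda>h. blinfun_apply (h *\<^sub>C cderiv Q z) (c *\<^sub>C x))) (at z)"
      by (rule bounded_linear.has_derivative [OF blinfun.bounded_linear_left D])
    have "((\<lambda>w. c *\<^sub>C blinfun_apply (Q w) x) has_derivative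
        (\<lambda>h. c *\<^sub>C blinfun_apply (h *\<^sub>C cderiv Q z) x)) (at z)"
      by (intro bounded_linear.has_derivative [OF bounded_linear_scaleC]
          bounded_linear.has_derivative [OF blinfun.bounded_linear_left D])
    then have "((\<lambda>w. blinfun_apply (Q w) (c *\<^sub>C x)) has_derivative
        (\<lambda>h. c *\<^sub>C blinfun_apply (h *\<^sub>C cderiv Q z) x)) (at z)"
      by (rule has_derivative_transform_within_open [OF _ \<open>open S\<close> \<open>z \<in> S\<close>])
        (use assms(3) in \<open>simp add: clinear_operators_def\<close>)
    from fun_cong [OF has_derivative_unique [OF 1 this], of 1] show ?thesis
      by simp
  qed
  then show ?thesis
    by (simp add: clinear_operators_def)
qed

text \<open>The real derivative contains the term \<open>Q z (h x)\<close> for complex increments \<open>h\<close>; it is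
  \<open>h (Q z x)\<close> by complex linearity of \<open>Q z\<close>. This is why the whole sum is a complex
  derivative.\<close>

lemma has_cderivative_blinfun_apply:
  fixes Q :: "complex \<Rightarrow> 'a :: complex_normed_vector \<Rightarrow>\<^sub>L 'a"
  assumes "Q z \<in> clinear_operators" "(Q has_cderivative A) (at z)" "(\<phi> has_cderivative x) (at z)"
  shows "((\<lambda>w. blinfun_apply (Q w) (\<phi> w)) has_cderivative
    (blinfun_apply A (\<phi> z) + blinfun_apply (Q z) x)) (at z)"
proof -
  have "((\<lambda>w. blinfun_apply (Q w) (\<phi> w)) has_derivative
      (\<lambda>h. blinfun_apply (Q z) (h *\<^sub>C x) + blinfun_apply (h *\<^sub>C A) (\<phi> z))) (at z)"
    using assms(2,3) unfolding has_cderivative_def by (rule blinfun.FDERIV)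
  then show ?thesis
    using assms(1)
    by (simp add: has_cderivative_def clinear_operators_def scaleC_blinfun.rep_eq
        scaleC_add_right add.commute)
qed

lemma has_cderivative_sum:
  assumes "\<And>i. i \<in> I \<Longrightarrow> (f i has_cderivative D i) F"
  shows "((\<lambda>z. \<Sum>i\<in>I. f i z) has_cderivative (\<Sum>i\<in>I. D i)) F"
  using has_derivative_sum [of I f "\<lambda>i h. h *\<^sub>C D i" F] assms
  by (simp add: has_cderivative_def scaleC.sum_right)

lemma has_cderivative_scaleC:
  assumes "(f has_cderivative D) F"
  shows "((\<lambda>z. c *\<^sub>C f z) has_cderivative (c *\<^sub>C D)) F"
  using bounded_linear.has_derivative [OF bounded_linear_scaleC, of f _ F c] assms
  by (fastforce simp: has_cderivative_def scaleC_scaleC mult.commute)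

text \<open>The combinatorial step of the Leibniz rule, with \<open>a p q\<close> in the role of
  \<open>Q\<^sup>(\<^sup>p\<^sup>) (\<phi>\<^sup>(\<^sup>q\<^sup>))\<close>. Dividing by \<open>p! q!\<close> in place of using binomial
  coefficients, the term \<open>a p q\<close> with \<open>p + q = n + 1\<close> is reached from \<open>p - 1\<close> with weight
  \<open>p\<close> and from \<open>q - 1\<close> with weight \<open>q\<close>, and \<open>p + q\<close> is constant.\<close>

lemma sum_shift_divided_factorials:
  fixes a :: "nat \<Rightarrow> nat \<Rightarrow> 'a :: complex_normed_vector"
  defines "c \<equiv> \<lambda>p q. 1 / (fact p * fact q) :: complex"
  shows "(\<Sum>p\<le>n. c p (n - p) *\<^sub>C (a (Suc p) (n - p) + a p (Suc (n - p)))) =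
    of_nat (Suc n) *\<^sub>C (\<Sum>p\<le>Suc n. c p (Suc n - p) *\<^sub>C a p (Suc n - p))"
proof -
  define b where "b p = c p (Suc n - p) *\<^sub>C a p (Suc n - p)" for p
  have c1: "c p (n - p) = of_nat (Suc p) * c (Suc p) (n - p)" for p
    by (simp add: c_def del: of_nat_Suc)
  have c2: "c p (n - p) = of_nat (Suc (n - p)) * c p (Suc (n - p))" for p
    by (simp add: c_def del: of_nat_Suc)
  have "(\<Sum>p\<le>n. c p (n - p) *\<^sub>C a (Suc p) (n - p)) = (\<Sum>p\<le>n. of_nat (Suc p) *\<^sub>C b (Suc p))"
    by (simp add: b_def c1 scaleC_scaleC del: of_nat_Suc)
  also have "\<dots> = (\<Sum>p\<le>Suc n. of_nat p *\<^sub>C b p)"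
    by (subst sum.atMost_Suc_shift) (simp add: scaleC.zero_left)
  finally have 1: "(\<Sum>p\<le>n. c p (n - p) *\<^sub>C a (Suc p) (n - p)) = (\<Sum>p\<le>Suc n. of_nat p *\<^sub>C b p)" .
  have "(\<Sum>p\<le>n. c p (n - p) *\<^sub>C a p (Suc (n - p))) = (\<Sum>p\<le>n. of_nat (Suc n - p) *\<^sub>C b p)"
    by (intro sum.cong)
      (simp_all add: b_def c2 scaleC_scaleC Suc_diff_le del: of_nat_Suc)
  also have "\<dots> = (\<Sum>p\<le>Suc n. of_nat (Suc n - p) *\<^sub>C b p)"
    by (simp add: scaleC.zero_left)
  finally have 2: "(\<Sum>p\<le>n. c p (n - p) *\<^sub>C a p (Suc (n - p))) =
    (\<Sum>p\<le>Suc n. of_nat (Suc n - p) *\<^sub>C b p)" .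
  have "(\<Sum>p\<le>Suc n. of_nat p *\<^sub>C b p) + (\<Sum>p\<le>Suc n. of_nat (Suc n - p) *\<^sub>C b p) =
    (\<Sum>p\<le>Suc n. of_nat (Suc n) *\<^sub>C b p)"
    unfolding sum.distrib [symmetric] scaleC_add_left [symmetric] of_nat_add [symmetric]
    by (intro sum.cong) simp_all
  then show ?thesis
    by (simp only: scaleC_add_right sum.distrib 1 2 scaleC.sum_right b_def)
qed

text \<open>By induction on \<open>n\<close>, using \<open>(G n)' = (n + 1) G (n + 1)\<close>. The formula is needed on
  the open set \<open>S\<close> and not only at one point, because the next derivative is taken of it.\<close>

lemma higher_cderiv_blinfun_apply:
  fixes Q :: "complex \<Rightarrow> 'a :: complex_hilbert_space \<Rightarrow>\<^sub>L 'a"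
  assumes "open S" and Q: "\<And>w. w \<in> S \<Longrightarrow> Q w \<in> clinear_operators" "Q cholomorphic_on S"
    and \<phi>: "\<phi> cholomorphic_on S"
  defines "G \<equiv> \<lambda>n z. \<Sum>p\<le>n. (1 / (fact p * fact (n - p))) *\<^sub>C
    blinfun_apply ((cderiv ^^ p) Q z) ((cderiv ^^ (n - p)) \<phi> z)"
  assumes "z \<in> S"
  shows "(cderiv ^^ n) (\<lambda>w. blinfun_apply (Q w) (\<phi> w)) z = fact n *\<^sub>C G n z"
    and "(cderiv ^^ n) (\<lambda>w. blinfun_apply (Q w) (\<phi> w)) cdifferentiable (at z)"
proof -
  note Q' = higher_cderiv_cholomorphic_on [OF norming_functionals_blinfun Q(2) \<open>open S\<close>]
  have lin: "(cderiv ^^ p) Q w \<in> clinear_operators" if "w \<in> S" for p w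
    using that
  proof (induction p arbitrary: w)
    case (Suc p)
    then show ?case
      using cderiv_clinear_operators [OF \<open>open S\<close>, of w "(cderiv ^^ p) Q"] Q' by simp
  qed (simp add: Q)
  have G': "(G n has_cderivative (of_nat (Suc n) *\<^sub>C G (Suc n) w)) (at w)" if "w \<in> S" for n w
    unfolding G_def
    by (subst sum_shift_divided_factorials [symmetric])
      (intro has_cderivative_sum has_cderivative_scaleC has_cderivative_blinfun_apply lin that
        higher_cderiv_has_cderivative [OF norming_functionals_blinfun Q(2) \<open>open S\<close>]
        higher_cderiv_has_cderivative [OF norming_functionals_cinner \<phi> \<open>open S\<close>])
  have F': "((cderiv ^^ n) (\<lambda>w. blinfun_apply (Q w) (\<phi> w)) has_cderivative
      fact (Suc n) *\<^sub>C G (Suc n) w) (at w)"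
    if "\<And>w. w \<in> S \<Longrightarrow> (cderiv ^^ n) (\<lambda>w. blinfun_apply (Q w) (\<phi> w)) w = fact n *\<^sub>C G n w"
      and "w \<in> S" for n w
  proof (rule has_cderivative_transform_open [OF _ \<open>open S\<close> \<open>w \<in> S\<close>])
    show "((\<lambda>w. fact n *\<^sub>C G n w) has_cderivative fact (Suc n) *\<^sub>C G (Suc n) w) (at w)"
      using has_cderivative_scaleC [OF G' [OF \<open>w \<in> S\<close>, of n], of "fact n"]
      by (simp add: scaleC_scaleC mult.commute)
  qed (simp add: that)
  have F: "(cderiv ^^ n) (\<lambda>w. blinfun_apply (Q w) (\<phi> w)) w = fact n *\<^sub>C G n w" if "w \<in> S" for n w
    using that
  proof (induction n arbitrary: w)
    case 0
    then show ?case
      by (simp add: G_def)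
  next
    case (Suc n)
    then show ?case
      using cderiv_eqI [OF F'] by simp
  qed
  show "(cderiv ^^ n) (\<lambda>w. blinfun_apply (Q w) (\<phi> w)) z = fact n *\<^sub>C G n z"
    by (rule F) fact
  show "(cderiv ^^ n) (\<lambda>w. blinfun_apply (Q w) (\<phi> w)) cdifferentiable (at z)"
    by (rule has_cderivative_imp_cdifferentiable) (rule F' [OF F \<open>z \<in> S\<close>])
qed

section \<open>Root functions\<close>

text \<open>Since \<open>z \<mapsto> Q z (\<phi> z)\<close> has continuous derivatives of all orders at \<open>\<alpha>\<close>, their
  limits there are their values, which the Leibniz rule computes.\<close>

lemma root_function_of_order_at_least_iff:
  fixes Q :: "complex \<Rightarrow> 'a :: complex_hilbert_space \<Rightarrow>\<^sub>L 'a"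
  assumes "open S" "\<alpha> \<in> S" "\<And>w. w \<in> S \<Longrightarrow> Q w \<in> clinear_operators" "Q cholomorphic_on S"
    and "\<phi> cholomorphic_on S" "\<phi> \<alpha> \<noteq> 0"
  shows "root_function_of_order_at_least Q \<alpha> m \<phi> \<longleftrightarrow>
    (\<forall>j<m. (\<Sum>p\<le>j. (1 / (fact p * fact (j - p))) *\<^sub>C
       blinfun_apply ((cderiv ^^ p) Q \<alpha>) ((cderiv ^^ (j - p)) \<phi> \<alpha>)) = 0)"
    (is "_ \<longleftrightarrow> (\<forall>j<m. ?G j = 0)")
proof -
  define f where "f = (\<lambda>z. blinfun_apply (Q z) (\<phi> z))"
  have leibniz: "(cderiv ^^ i) f \<alpha> = fact i *\<^sub>C ?G i" for i
    unfolding f_def by (rule higher_cderiv_blinfun_apply(1) [OF assms(1) _ assms(4,5,2)]) (rule assms(3))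
  have cdiff: "(cderiv ^^ i) f cdifferentiable (at z)" if "z \<in> S" for i z
    unfolding f_def by (rule higher_cderiv_blinfun_apply(2) [OF assms(1) _ assms(4,5) that]) (rule assms(3))
  have diff: "\<forall>\<^sub>F z in at \<alpha>. (cderiv ^^ i) f cdifferentiable (at z)" for i
    using eventually_at_in_open' [OF assms(1,2)] by eventually_elim (rule cdiff)
  have "((cderiv ^^ i) f \<longlongrightarrow> (cderiv ^^ i) f \<alpha>) (at \<alpha>)" for i
    using cdifferentiable_imp_continuous [OF cdiff [OF \<open>\<alpha> \<in> S\<close>]]
    by (simp add: continuous_at isCont_def)
  then have "((cderiv ^^ i) f \<longlongrightarrow> 0) (at \<alpha>) \<longleftrightarrow> (cderiv ^^ i) f \<alpha> = 0" for i
    using tendsto_unique [OF trivial_limit_at] by metis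
  moreover have "(cderiv ^^ i) f \<alpha> = 0 \<longleftrightarrow> ?G i = 0" for i
    by (simp add: leibniz scaleC_eq_0_iff)
  ultimately show ?thesis
    using diff \<open>\<phi> \<alpha> \<noteq> 0\<close>
    by (simp add: root_function_of_order_at_least_def f_def [symmetric])
qed

theorem proposition2p1:
  fixes Q :: "complex \<Rightarrow> 'a :: complex_hilbert_space \<Rightarrow>\<^sub>L 'a"
    and D :: "complex set"
    and \<alpha> :: complex
    and l :: nat
    and \<phi> :: "complex \<Rightarrow> 'a"
  assumes "open D" and "connected D"
    and "Q ` D \<subseteq> clinear_operators"
    and "Q cholomorphic_on D"
    and "l \<ge> 1"
    and "\<alpha> \<in> D"
    and "zero_of_order_at_least Q \<alpha> l"
    and "\<phi> cholomorphic_at \<alpha>"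
    and "\<phi> \<alpha> \<noteq> 0"
  shows "root_function_of_order_at_least Q \<alpha> l \<phi> \<longleftrightarrow>
    (\<exists>R. (\<exists>M>0. \<forall>\<^sub>F z in at \<alpha>. norm (R z) \<le> M * cmod (z - \<alpha>)) \<and>
         (\<forall>\<^sub>F z in nhds \<alpha>.
            \<phi> z = (\<Sum>s=0..l-1. (1 / fact s) *\<^sub>C (z - \<alpha>) ^ s *\<^sub>C (cderiv ^^ s) \<phi> \<alpha>)
                  + (z - \<alpha>) ^ (l - 1) *\<^sub>C R z)) \<and>
    (\<forall>j\<in>{0..l-1}.
       (\<Sum>p=0..j. (1 / (fact p * fact (j - p))) *\<^sub>C
          blinfun_apply ((cderiv ^^ p) Q \<alpha>) ((cderiv ^^ (j - p)) \<phi> \<alpha>)) = 0)"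
proof -
  obtain e where "0 < e" and e: "\<phi> cholomorphic_on ball \<alpha> e"
    using \<open>\<phi> cholomorphic_at \<alpha>\<close> unfolding cholomorphic_at_def by blast
  define S where "S = D \<inter> ball \<alpha> e"
  have S: "open S" "\<alpha> \<in> S" "\<And>w. w \<in> S \<Longrightarrow> Q w \<in> clinear_operators" "Q cholomorphic_on S"
    "\<phi> cholomorphic_on S"
    using assms \<open>0 < e\<close> cholomorphic_on_subset [OF e, of S]
      cholomorphic_on_subset [OF \<open>Q cholomorphic_on D\<close>, of S]
    by (auto simp: S_def)
  define T where "T z = (\<Sum>s=0..l-1. (1 / fact s) *\<^sub>C (z - \<alpha>) ^ s *\<^sub>C (cderiv ^^ s) \<phi> \<alpha>)" for z
  \<comment> \<open>At \<open>z = \<alpha>\<close> the factor \<open>(z - \<alpha>) ^ (l - 1)\<close> is \<open>0\<close>, or \<open>1\<close> if \<open>l = 1\<close>; the expansion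
    holds there in both cases because \<open>T \<alpha> = \<phi> \<alpha>\<close>.\<close>
  define R where "R z = inverse ((z - \<alpha>) ^ (l - 1)) *\<^sub>C (\<phi> z - T z)" for z
  obtain M where "0 < M" and M: "\<forall>\<^sub>F z in nhds \<alpha>. norm (\<phi> z - T z) \<le> M * cmod (z - \<alpha>) ^ Suc (l - 1)"
    using cholomorphic_Taylor_bound [OF norming_functionals_cinner S(5,1,2), of "l - 1"]
    unfolding T_def atMost_atLeast0 by blast
  have "T \<alpha> = \<phi> \<alpha>"
  proof -
    have "T \<alpha> = (\<Sum>s=0..l-1. if s = 0 then \<phi> \<alpha> else 0)"
      unfolding T_def by (intro sum.cong) (auto simp: scaleC.zero_left scaleC.zero_right power_0_left)
    then show ?thesis
      by simp
  qed
  then have split: "\<phi> z = T z + (z - \<alpha>) ^ (l - 1) *\<^sub>C R z" for z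
    by (cases "z = \<alpha>") (simp_all add: R_def scaleC_scaleC scaleC.zero_right)
  have "\<forall>\<^sub>F z in at \<alpha>. norm (R z) \<le> M * cmod (z - \<alpha>)"
  proof -
    have "\<forall>\<^sub>F z in at \<alpha>. norm (\<phi> z - T z) \<le> M * cmod (z - \<alpha>) ^ Suc (l - 1)"
      using M by (simp add: eventually_nhds_conv_at)
    moreover have "\<forall>\<^sub>F z in at \<alpha>. z \<noteq> \<alpha>"
      by (rule eventually_neq_at_within)
    ultimately show ?thesis
    proof eventually_elim
      case (elim z)
      have "norm (R z) = norm (\<phi> z - T z) / cmod (z - \<alpha>) ^ (l - 1)"
        by (simp add: R_def norm_scaleC norm_inverse norm_power divide_inverse mult.commute)
      then show ?case
        using elim by (simp add: pos_divide_le_eq mult_ac)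
    qed
  qed
  with split \<open>0 < M\<close> have taylor: "\<exists>R. (\<exists>M>0. \<forall>\<^sub>F z in at \<alpha>. norm (R z) \<le> M * cmod (z - \<alpha>)) \<and>
      (\<forall>\<^sub>F z in nhds \<alpha>. \<phi> z = T z + (z - \<alpha>) ^ (l - 1) *\<^sub>C R z)"
    by (intro exI [of _ R]) (auto intro: always_eventually)
  have "j < l \<longleftrightarrow> j \<in> {0..l-1}" for j
    using \<open>l \<ge> 1\<close> by auto
  with root_function_of_order_at_least_iff [OF S \<open>\<phi> \<alpha> \<noteq> 0\<close>, of l]
  have "root_function_of_order_at_least Q \<alpha> l \<phi> \<longleftrightarrow>
    (\<forall>j\<in>{0..l-1}.
       (\<Sum>p=0..j. (1 / (fact p * fact (j - p))) *\<^sub>C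
          blinfun_apply ((cderiv ^^ p) Q \<alpha>) ((cderiv ^^ (j - p)) \<phi> \<alpha>)) = 0)"
    unfolding atMost_atLeast0 by blast
  with taylor show ?thesis
    unfolding T_def by blast
qed

end
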